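(* Let $s$ and $t$ be groupoid terms which have a cycle. Then there is a finite groupoid that separates $s$ and $t$.
   Context: A groupoid $\langle G,\star\rangle$ is a nonempty set $G$ with a single binary operation $\star$ (no axioms assumed). Groupoid terms are formal expressions built from variables using $\star$; variables may be repeated, may appear in any order, and $s$ and $t$ need not involve the same variables. A groupoid $G$ separates $s$ and $t$ if for every assignment of elements of $G$ to the variables occurring in $s$ or $t$, the resulting values of $s$ and $t$ in $G$ are different. Paths: each groupoid term $s$ corresponds to a full binary tree $T(s)$: if $s$ is a variable, $T(s)$ is a single node labelled by it, and $T(s_1\star s_2)$ has a root with left subtree $T(s_1)$ and right subtree $T(s_2)$. Nodes are labelled by strings in $\{l,r\}^*$: the root has label the empty string $\Lambda$, and the left and right children of a node labelled $a$ are labelled $al$ and $ar$. Each occurrence $x'$ of a variable in $s$ corresponds to a leaf of $T(s)$; the label of this leaf is the path of the occurrence, written $\mathrm{path}_s(x')$. A string $q$ is an initial substring of $p$ if $p=qu$ for some (possibly empty) string $u$; it is proper if $q\neq p$. For variables $y,z$ (possibly equal), $y$ occurs above $z$ (relative to $s$ and $t$) if there are occurrences $y'$ of $y$ and $z'$ of $z$ such that either $y'$ is in $s$, $z'$ is in $t$, and $\mathrm{path}_s(y')$ is an initial substring of $\mathrm{path}_t(z')$, or $y'$ is in $t$, $z'$ is in $s$, and $\mathrm{path}_t(y')$ is an initial substring of $\mathrm{path}_s(z')$. It occurs strictly above if the same holds with "proper initial substring". The terms $s$ and $t$ have a cycle if there is a sequence of variables $y_0,y_1,\dots,y_{m-1}$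 with $m\geq 1$ such that $y_0$ occurs above $y_1$, $y_1$ occurs above $y_2$, and so on, ending with $y_{m-1}$ occurring above $y_0$, where at least one of these relations is "occurs strictly above". *)

theory Defs
  imports Main "HOL-Library.Sublist"
begin

datatype (vars: 'v) gterm = Var 'v | Op "'v gterm" "'v gterm"

text \<open>A groupoid is given by a carrier set and an operation, whose values outside the
  carrier are irrelevant.\<close>

definition groupoid :: "'a set \<Rightarrow> ('a \<Rightarrow> 'a \<Rightarrow> 'a) \<Rightarrow> bool" where
  "groupoid G f \<longleftrightarrow> G \<noteq> {} \<and> (\<forall>a\<in>G. \<forall>b\<in>G. f a b \<in> G)"

primrec eval_gterm :: "('a \<Rightarrow> 'a \<Rightarrow> 'a) \<Rightarrow> ('v \<Rightarrow> 'a) \<Rightarrow> 'v gterm \<Rightarrow> 'a" where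
  "eval_gterm f h (Var x) = h x"
| "eval_gterm f h (Op u v) = f (eval_gterm f h u) (eval_gterm f h v)"

definition separates ::
  "'a set \<Rightarrow> ('a \<Rightarrow> 'a \<Rightarrow> 'a) \<Rightarrow> 'v gterm \<Rightarrow> 'v gterm \<Rightarrow> bool" where
  "separates G f s t \<longleftrightarrow>
     (\<forall>h. (\<forall>x \<in> vars s \<union> vars t. h x \<in> G) \<longrightarrow> eval_gterm f h s \<noteq> eval_gterm f h t)"

datatype dir = L | R

text \<open>An occurrence of a variable in a term is determined by its path, the string of
  directions read from the root to the leaf, so occurrences are represented as pairs of a
  variable and a path.\<close>

primrec occs :: "'v gterm \<Rightarrow> ('v \<times> dir list) set" where
  "occs (Var x) = {(x, [])}"
| "occs (Op u v) = {(x, L # p) | x p. (x, p) \<in> occs u} \<union> {(x, R # p) | x p. (x, p) \<in> occs v}"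

definition occurs_above :: "'v gterm \<Rightarrow> 'v gterm \<Rightarrow> 'v \<Rightarrow> 'v \<Rightarrow> bool" where
  "occurs_above s t y z \<longleftrightarrow>
     (\<exists>p q. prefix p q \<and>
        ((y, p) \<in> occs s \<and> (z, q) \<in> occs t \<or> (y, p) \<in> occs t \<and> (z, q) \<in> occs s))"

definition occurs_strictly_above :: "'v gterm \<Rightarrow> 'v gterm \<Rightarrow> 'v \<Rightarrow> 'v \<Rightarrow> bool" where
  "occurs_strictly_above s t y z \<longleftrightarrow>
     (\<exists>p q. strict_prefix p q \<and>
        ((y, p) \<in> occs s \<and> (z, q) \<in> occs t \<or> (y, p) \<in> occs t \<and> (z, q) \<in> occs s))"

definition has_cycle :: "'v gterm \<Rightarrow> 'v gterm \<Rightarrow> bool" where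
  "has_cycle s t \<longleftrightarrow>
     (\<exists>(y :: nat \<Rightarrow> 'v) m. m \<ge> 1 \<and>
        (\<forall>i<m. occurs_above s t (y i) (y (Suc i mod m))) \<and>
        (\<exists>i<m. occurs_strictly_above s t (y i) (y (Suc i mod m))))"

end

theory Submission
  imports Defs "HOL-Library.FuncSet" "HOL-Library.Omega_Words_Fun" "HOL-Number_Theory.Cong"
begin

text \<open>Write the path of the lower occurrence in the \<open>i\<close>-th step of the cycle as the path of the
  upper one followed by \<open>u\<^sub>i\<close>. Let an element of the groupoid be a function from infinite
  words over \<open>{L, R}\<close> to the integers modulo \<open>M\<close>, where the value of a product at a word is one
  more than the value, at the tail of that word, of the factor selected by its first letter. Then a
  term whose variable \<open>x\<close> occurs at path \<open>p\<close> has at \<open>p w\<close> the value of \<open>x\<close> at \<open>w\<close> plus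
  the length of \<open>p\<close>. If \<open>s\<close> and \<open>t\<close> had equal values, then following the cycle along the word
  \<open>(u\<^sub>0 u\<^sub>1 ... )\<^sup>\<omega>\<close> would give that the length \<open>l\<close> of a period is 0 modulo \<open>M\<close>, which
  fails for \<open>M = l + 1\<close> because \<open>l > 0\<close> by strictness. Only words in a finite set closed under tails matter,
  namely those that are \<open>l\<close>-periodic from a fixed position on; so the groupoid can be taken finite.\<close>

lemma eval_gterm_closed:
  assumes "groupoid G f" "\<forall>x\<in>vars t. h x \<in> G"
  shows "eval_gterm f h t \<in> G"
  using assms(2)
  by (induction t) (use assms(1) in \<open>auto simp: groupoid_def\<close>)

lemma eval_gterm_hom:
  assumes "groupoid G f" "\<forall>x\<in>vars t. h x \<in> G"
    and "\<And>a b. a \<in> G \<Longrightarrow> b \<in> G \<Longrightarrow> \<phi> (f a b) = g (\<phi> a) (\<phi> b)"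
  shows "\<phi> (eval_gterm f h t) = eval_gterm g (\<phi> \<circ> h) t"
  using assms(2)
proof (induction t)
  case (Op u v)
  then show ?case
    using assms(3)[of "eval_gterm f h u" "eval_gterm f h v"]
    by (simp add: eval_gterm_closed[OF assms(1)])
qed simp

text \<open>Moves a groupoid of functions onto natural numbers. The bijection \<open>\<phi>\<close>
  is a homomorphism from the copy to \<open>G\<close>, so equal values of \<open>s\<close> and
  \<open>t\<close> in the copy would give equal values in \<open>G\<close>.\<close>

lemma separates_nat:
  assumes "finite G" "groupoid G f" "separates G f s t"
  shows "\<exists>(H :: nat set) g. finite H \<and> groupoid H g \<and> separates H g s t"
proof -
  define H where "H = {0..<card G}"
  obtain \<phi> where \<phi>: "bij_betw \<phi> H G"
    using ex_bij_betw_nat_finite[OF assms(1)] unfolding H_def by blast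
  define \<psi> where "\<psi> = inv_into H \<phi>"
  have \<psi>: "\<psi> a \<in> H" if "a \<in> G" for a
    using \<phi> that unfolding \<psi>_def by (metis bij_betw_def inv_into_into)
  have \<phi>\<psi>: "\<phi> (\<psi> a) = a" if "a \<in> G" for a
    using \<phi> that unfolding \<psi>_def by (metis bij_betw_inv_into_right)
  have \<phi>_in: "\<phi> a \<in> G" if "a \<in> H" for a
    using \<phi> that by (metis bij_betwE)
  define g where "g a b = \<psi> (f (\<phi> a) (\<phi> b))" for a b
  have closed: "f a b \<in> G" if "a \<in> G" "b \<in> G" for a b
    using assms(2) that by (auto simp: groupoid_def)
  have H: "groupoid H g"
    using assms(2) \<psi> closed \<phi>_in unfolding groupoid_def g_def by (meson all_not_in_conv)
  have hom: "\<phi> (g a b) = f (\<phi> a) (\<phi> b)" if "a \<in> H" "b \<in> H" for a b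
    unfolding g_def using that by (simp add: \<phi>\<psi> closed \<phi>_in)
  have "separates H g s t"
    unfolding separates_def
  proof (intro allI impI)
    fix h assume h: "\<forall>x\<in>vars s \<union> vars t. h x \<in> H"
    have "eval_gterm f (\<phi> \<circ> h) s \<noteq> eval_gterm f (\<phi> \<circ> h) t"
      using assms(3) h \<phi>_in unfolding separates_def by (metis comp_apply)
    moreover have "\<phi> (eval_gterm g h s) = eval_gterm f (\<phi> \<circ> h) s"
      "\<phi> (eval_gterm g h t) = eval_gterm f (\<phi> \<circ> h) t"
      using h by (auto intro!: eval_gterm_hom[OF H] hom)
    ultimately show "eval_gterm g h s \<noteq> eval_gterm g h t" by metis
  qed
  then show ?thesis
    using H unfolding H_def by blast
qed

definition ev_periodic :: "nat \<Rightarrow> nat \<Rightarrow> 'a word set" where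
  "ev_periodic N l = {w. \<forall>i\<ge>N. w (i + l) = w i}"

text \<open>A word in the set is determined by its first \<open>N + l\<close> letters, since each
  later letter repeats the one \<open>l\<close> positions before it.\<close>

lemma finite_ev_periodic:
  assumes "l > 0"
  shows "finite (ev_periodic N l :: ('a :: finite) word set)"
proof (rule inj_on_finite)
  let ?pre = "\<lambda>w :: 'a word. map w [0..<N + l]"
  show "inj_on ?pre (ev_periodic N l)"
  proof (rule inj_onI, rule ext)
    fix v w :: "'a word" and n
    assume v: "v \<in> ev_periodic N l" and w: "w \<in> ev_periodic N l" and eq: "?pre v = ?pre w"
    show "v n = w n"
    proof (induction n rule: less_induct)
      case (less n)
      show ?case
      proof (cases "n < N + l")
        case True
        then show ?thesis using eq by simp
      next
        case False
        then have "N \<le> n - l" by simp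
        then have "v (n - l + l) = v (n - l)" "w (n - l + l) = w (n - l)"
          using v w unfolding ev_periodic_def by blast+
        then show ?thesis using less[of "n - l"] False assms by simp
      qed
    qed
  qed
  show "?pre ` ev_periodic N l \<subseteq> {xs. set xs \<subseteq> UNIV \<and> length xs = N + l}" by auto
  show "finite {xs :: 'a list. set xs \<subseteq> UNIV \<and> length xs = N + l}"
    by (rule finite_lists_length_eq) simp
qed

lemma suffix_ev_periodic:
  "w \<in> ev_periodic N l \<Longrightarrow> Omega_Words_Fun.suffix k w \<in> ev_periodic N l"
  by (auto simp: ev_periodic_def ac_simps) (metis add.commute add.left_commute trans_le_add1)

lemma iter_ev_periodic:
  assumes "u \<noteq> []" "length v \<le> N"
  shows "v \<frown> u\<^sup>\<omega> \<in> ev_periodic N (length u)"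
proof -
  \<comment> \<open>As \<open>length v \<le> N \<le> i\<close>, the truncated subtraction is a true
    one.\<close>
  have "(i + length u - length v) mod length u = (i - length v) mod length u" if "N \<le> i" for i
    using assms(2) that by (metis le_trans mod_add_self2 Nat.add_diff_assoc2)
  then show ?thesis
    using assms by (auto simp: ev_periodic_def conc_def iter_def)
qed

instance dir :: finite
proof
  have "UNIV = {L, R}" by (auto intro: dir.exhaust)
  then show "finite (UNIV :: dir set)" by (metis finite.emptyI finite.insertI)
qed

text \<open>Restricting to \<open>K\<close> makes products extensional, so that they stay in
  \<open>K \<rightarrow>\<^sub>E {..<M}\<close>, which is finite for finite
  \<open>K\<close>.\<close>

definition word_op :: "dir word set \<Rightarrow> nat \<Rightarrow> (dir word \<Rightarrow> nat) \<Rightarrow> (dir word \<Rightarrow> nat) \<Rightarrow> dir word \<Rightarrow> nat"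
  where "word_op K M a b = (\<lambda>w\<in>K.
    Suc ((case w 0 of L \<Rightarrow> a | R \<Rightarrow> b) (Omega_Words_Fun.suffix 1 w)) mod M)"

lemma groupoid_word_op:
  assumes "M > 0"
  shows "groupoid (K \<rightarrow>\<^sub>E {..<M}) (word_op K M)"
  using assms by (auto simp: groupoid_def word_op_def PiE_eq_empty_iff)

text \<open>Each letter of \<open>p\<close> selects the factor containing the occurrence, is removed
  from the word and adds one. Closure of \<open>K\<close> under tails keeps all intermediate words
  in \<open>K\<close>, where the operation is not \<open>undefined\<close>.\<close>

lemma eval_word_op:
  assumes "\<And>w. w \<in> K \<Longrightarrow> Omega_Words_Fun.suffix 1 w \<in> K"
    and "(x, p) \<in> occs t" "p \<frown> w \<in> K"
  shows "[eval_gterm (word_op K M) h t (p \<frown> w) = h x w + length p] (mod M)"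
  using assms(2,3)
proof (induction t arbitrary: p)
  case (Var y)
  then show ?case by simp
next
  case (Op u v)
  have tl: "Omega_Words_Fun.suffix 1 ((d # q) \<frown> w) = q \<frown> w" for d :: dir and q
    by (auto simp: fun_eq_iff conc_def)
  have op: "word_op K M a b ((d # q) \<frown> w) = Suc ((case d of L \<Rightarrow> a | R \<Rightarrow> b) (q \<frown> w)) mod M"
    if "(d # q) \<frown> w \<in> K" for a b d q
    unfolding word_op_def restrict_apply tl using that by simp
  from Op.prems(1) consider q where "p = L # q" "(x, q) \<in> occs u"
    | q where "p = R # q" "(x, q) \<in> occs v"
    by auto
  then show ?case
  proof cases
    case 1
    then have "q \<frown> w \<in> K" using assms(1) Op.prems(2) tl by metis
    then have "[Suc (eval_gterm (word_op K M) h u (q \<frown> w)) = Suc (h x w + length q)] (mod M)"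
      using Op.IH(1) 1(2) by (simp add: cong_def) (metis mod_Suc_eq)
    then show ?thesis using op[of L q] Op.prems(2) 1(1)
      by (simp add: cong_def)
  next
    case 2
    then have "q \<frown> w \<in> K" using assms(1) Op.prems(2) tl by metis
    then have "[Suc (eval_gterm (word_op K M) h v (q \<frown> w)) = Suc (h x w + length q)] (mod M)"
      using Op.IH(2) 2(2) by (simp add: cong_def) (metis mod_Suc_eq)
    then show ?thesis using op[of R q] Op.prems(2) 2(1)
      by (simp add: cong_def)
  qed
qed

lemma finite_occs: "finite (occs t)"
proof (induction t)
  case (Op u v)
  have "occs (Op u v) = (\<lambda>(x, p). (x, L # p)) ` occs u \<union> (\<lambda>(x, p). (x, R # p)) ` occs v"
    by auto
  then show ?case using Op by simp
qed simp

text \<open>The upper occurrence may lie in \<open>s\<close> in one step and in \<open>t\<close> in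
  another: the assumed equality of values can be read in both directions.\<close>

lemma separates_if_steps:
  fixes y :: "nat \<Rightarrow> 'v"
  assumes "m \<ge> 1"
    and step: "\<And>i. i < m \<Longrightarrow> \<exists>p.
      (y i, p) \<in> occs s \<and> (y (Suc i mod m), p @ u i) \<in> occs t \<or>
      (y i, p) \<in> occs t \<and> (y (Suc i mod m), p @ u i) \<in> occs s"
    and "\<exists>i<m. u i \<noteq> []"
  shows "\<exists>K M. finite K \<and> M > 0 \<and> separates (K \<rightarrow>\<^sub>E {..<M}) (word_op K M) s t"
proof -
  define U where "U = concat (map u [0..<m])"
  define l where "l = length U"
  have U: "U \<noteq> []" using assms(3) by (auto simp: U_def)
  \<comment> \<open>What remains of the periodic word after the first \<open>i\<close> steps of a
    period.\<close>
  define W where "W i = concat (map u [i..<m]) \<frown> U\<^sup>\<omega>" for i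
  have W_Suc: "W i = u i \<frown> W (Suc i)" if "i < m" for i
    using that by (simp add: W_def upt_conv_Cons)
  have W_m: "W m = W 0"
    using U by (simp add: W_def flip: U_def iter_unroll)
  obtain D where D: "length p \<le> D" if "(x, p) \<in> occs s \<union> occs t" for x :: 'v and p
  proof
    show "length p \<le> Max ((length \<circ> snd) ` (occs s \<union> occs t))"
      if "(x, p) \<in> occs s \<union> occs t" for x p
      using that by (intro Max_ge) (auto simp: finite_occs image_iff intro: rev_bexI)
  qed
  \<comment> \<open>Before \<open>U\<^sup>\<omega>\<close> there are at most \<open>D\<close>
    letters of a path and \<open>l\<close> letters of a partial period.\<close>
  define K :: "dir word set" where "K = ev_periodic (D + l) l"
  have suffix_K: "Omega_Words_Fun.suffix 1 w \<in> K" if "w \<in> K" for w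
    using that suffix_ev_periodic unfolding K_def by blast
  have W_K: "p \<frown> W i \<in> K" if "length p \<le> D" "i \<le> m" for p i
  proof -
    have "[0..<m] = [0..<i] @ [i..<m]"
      using that(2) by (metis le0 le_add_diff_inverse upt_add_eq_append)
    then have "length (concat (map u [i..<m])) \<le> l"
      unfolding l_def U_def by simp
    then show ?thesis
      using that(1) iter_ev_periodic[OF U, of "p @ concat (map u [i..<m])" "D + l"]
      by (simp add: K_def W_def l_def)
  qed
  have "separates (K \<rightarrow>\<^sub>E {..<Suc l}) (word_op K (Suc l)) s t"
    unfolding separates_def
  proof (intro allI impI notI)
    fix h :: "'v \<Rightarrow> dir word \<Rightarrow> nat"
    let ?e = "eval_gterm (word_op K (Suc l)) h"
    assume eq: "?e s = ?e t"
    have one: "[h (y i) (W i) = h (y (Suc i mod m)) (W (Suc i)) + length (u i)] (mod Suc l)"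
      if i: "i < m" for i
    proof -
      obtain p a b where p: "(y i, p) \<in> occs a" "(y (Suc i mod m), p @ u i) \<in> occs b"
        and ab: "a = s \<and> b = t \<or> a = t \<and> b = s"
        using step[OF i] by metis
      have in_K: "p \<frown> W i \<in> K" "(p @ u i) \<frown> W (Suc i) \<in> K"
        using p ab i by (auto intro!: W_K D simp del: conc_conc)
      \<comment> \<open>Both arguments are the same word, split after the upper path and after the
        lower one.\<close>
      have same: "?e a (p \<frown> W i) = ?e b ((p @ u i) \<frown> W (Suc i))"
        using ab eq by (auto simp: W_Suc[OF i])
      have "[h (y i) (W i) + length p
          = h (y (Suc i mod m)) (W (Suc i)) + length (p @ u i)] (mod Suc l)"
        using eval_word_op[OF suffix_K p(1) in_K(1), of "Suc l" h]
          eval_word_op[OF suffix_K p(2) in_K(2), of "Suc l" h] same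
        by (metis cong_sym cong_trans)
      then have "[h (y i) (W i) + length p
          = h (y (Suc i mod m)) (W (Suc i)) + length (u i) + length p] (mod Suc l)"
        by (simp add: ac_simps)
      then show ?thesis by (simp only: cong_add_rcancel_nat)
    qed
    \<comment> \<open>The steps telescope. For \<open>i = m\<close> both the variable and the word
      are back at the start.\<close>
    have "[h (y 0) (W 0) = h (y (i mod m)) (W i) + length (concat (map u [0..<i]))] (mod Suc l)"
      if "i \<le> m" for i
      using that
    proof (induction i)
      case (Suc i)
      then have "[h (y 0) (W 0) = h (y i) (W i) + length (concat (map u [0..<i]))] (mod Suc l)"
        by simp
      also have "[h (y i) (W i) + length (concat (map u [0..<i])) =
          h (y (Suc i mod m)) (W (Suc i)) + length (u i) + length (concat (map u [0..<i]))]
          (mod Suc l)"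
        using one Suc.prems by (intro cong_add) auto
      finally show ?case by (simp add: ac_simps)
    qed simp
    from this[of m] have "[h (y 0) (W 0) = h (y 0) (W 0) + l] (mod Suc l)"
      by (simp add: W_m l_def U_def)
    then have "[l = 0] (mod Suc l)"
      using cong_add_lcancel_0_nat cong_sym by blast
    then show False using U by (simp add: cong_def l_def)
  qed
  moreover have "finite K"
    using U by (simp add: K_def l_def finite_ev_periodic)
  ultimately show ?thesis by blast
qed

theorem theorem4p2:
  fixes s t :: "'v gterm"
  assumes "has_cycle s t"
  shows "\<exists>(G :: nat set) (f :: nat \<Rightarrow> nat \<Rightarrow> nat). finite G \<and> groupoid G f \<and> separates G f s t"
proof -
  obtain y :: "nat \<Rightarrow> 'v" and m where m: "m \<ge> 1"
    and above: "\<And>i. i < m \<Longrightarrow> occurs_above s t (y i) (y (Suc i mod m))"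
    and strict: "\<exists>i<m. occurs_strictly_above s t (y i) (y (Suc i mod m))"
    using assms unfolding has_cycle_def by blast
  define step where "step i v \<longleftrightarrow> (\<exists>p.
      (y i, p) \<in> occs s \<and> (y (Suc i mod m), p @ v) \<in> occs t \<or>
      (y i, p) \<in> occs t \<and> (y (Suc i mod m), p @ v) \<in> occs s)" for i v
  have ex_step: "\<exists>v. step i v" if "i < m" for i
    using above[OF that] unfolding occurs_above_def step_def Sublist.prefix_def by blast
  obtain k v where k: "k < m" "step k v" "v \<noteq> []"
    using strict unfolding occurs_strictly_above_def step_def
    by (auto simp: strict_prefix_def Sublist.prefix_def)
  \<comment> \<open>Several pairs of occurrences may realise a step; at \<open>k\<close> the strict
    one is forced, as an arbitrary choice could be empty.\<close>
  define u where "u i = (if i = k then v else SOME v. step i v)" for i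
  have u: "step i (u i)" if "i < m" for i
    using k ex_step[OF that] by (auto simp: u_def intro: someI)
  have "\<exists>i<m. u i \<noteq> []"
    using k by (auto simp: u_def)
  from separates_if_steps[OF m u[unfolded step_def] this] obtain K M where "finite K" "M > 0" "separates (K \<rightarrow>\<^sub>E {..<M}) (word_op K M) s t"
    by blast
  then show ?thesis
    by (intro separates_nat[OF _ groupoid_word_op]) (auto intro: finite_PiE)
qed

end
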